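(* Let $s\in(0,1/2)$ and $n=1$. For $r\ge 0$ define $$\mathcal{T}_s(r):=\int_{\mathbb{R}}S_s(\xi)\,|\widehat{\chi_{I_r}}(\xi)|^2\,d\xi,$$ where $I_r\subset\mathbb{R}$ is a connected interval of length $r$ (the value depends only on $r$). Then $\mathcal{T}_s(r)$ is positive for $r>0$, and there exist two positive constants $C_1$ and $C_2$ depending only on $s$ such that $$\lim_{r\to0^+}\frac{\mathcal{T}_s(r)}{r^{1-2s}}=C_1\qquad\text{and}\qquad\lim_{r\to+\infty}\mathcal{T}_s(r)=C_2 .$$
   Context: $\chi_{I_r}$ is the characteristic function of $I_r$. Fourier transform convention: $\widehat{u}(\xi)=\int_{\mathbb{R}}u(x)e^{-ix\xi}\,dx$. The symbol $S_s$ is, for $\xi\neq0$, $$S_s(\xi):=c_1(s)\,\frac{J_{1-s}(-i|\xi|)}{J_{s-1}(-i|\xi|)}\,|\xi|^{2s},\qquad c_1(s):=i\left(\frac{1-i}{2}\right)^{4s-2}\frac{\Gamma(1-s)}{\Gamma(s)},$$ where $J_k$ is the Bessel function of the first kind of order $k$; complex powers and $J_k$ are taken with principal branches. *)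

theory Defs
  imports "HOL-Analysis.Analysis"
begin

text \<open>
  Bessel function of the first kind of order \<open>\<nu>\<close>, by its power series with the principal branch
  of the power. Pitfall: \<open>0 powr \<nu> = 0\<close> for every \<open>\<nu>\<close>, so the value at \<open>z = 0\<close> is \<open>0\<close>
  even for \<open>\<nu> = 0\<close>; below only \<open>z \<noteq> 0\<close> matters.
\<close>

definition bessel_J :: "complex \<Rightarrow> complex \<Rightarrow> complex" where
  "bessel_J \<nu> z =
     (z / 2) powr \<nu> *
     (\<Sum>k. (- 1) ^ k * rGamma (\<nu> + of_nat k + 1) / fact k * (z / 2) ^ (2 * k))"

definition fourier :: "(real \<Rightarrow> complex) \<Rightarrow> real \<Rightarrow> complex" where
  "fourier u \<xi> = (LINT x|lborel. u x * exp (- \<i> * of_real x * of_real \<xi>))"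

definition c1 :: "real \<Rightarrow> complex" where
  "c1 s = \<i> * ((1 - \<i>) / 2) powr of_real (4 * s - 2) * of_real (Gamma (1 - s) / Gamma s)"

text \<open>The symbol is meant for \<open>\<xi> \<noteq> 0\<close>; at \<open>\<xi> = 0\<close> it takes the value \<open>0\<close>.\<close>

definition symb :: "real \<Rightarrow> real \<Rightarrow> complex" where
  "symb s \<xi> =
     c1 s * (bessel_J (of_real (1 - s)) (- \<i> * of_real \<bar>\<xi>\<bar>)
             / bessel_J (of_real (s - 1)) (- \<i> * of_real \<bar>\<xi>\<bar>))
          * of_real (\<bar>\<xi>\<bar> powr (2 * s))"

definition T_set :: "real \<Rightarrow> real set \<Rightarrow> complex" where
  "T_set s I =
     (LINT \<xi>|lborel. symb s \<xi> * of_real ((cmod (fourier (indicator I) \<xi>))\<^sup>2))"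

text \<open>
  The interval \<open>{0..r}\<close> is an arbitrary representative of the intervals of length \<open>r\<close>.
  The symbol is given by a complex formula, so the integral is complex valued. The integral
  of a non-integrable function is \<open>0\<close>, so \<open>T s r \<noteq> 0\<close> entails convergence.
\<close>

definition T :: "real \<Rightarrow> real \<Rightarrow> complex" where
  "T s r = T_set s {0..r}"

end

theory Submission
  imports Defs
begin

text \<open>
  For \<open>\<xi> \<noteq> 0\<close> the phases in \<open>symb\<close> cancel and \<open>S\<^sub>s(\<xi>)\<close> is a positive multiple of
  \<open>\<bar>\<xi>\<bar> powr (2 * s) * (I\<^bsub>1-s\<^esub> / I\<^bsub>s-1\<^esub>)(\<bar>\<xi>\<bar>)\<close> with modified Bessel functions \<open>I\<close>.
  Their Wronskian shows that the quotient is increasing and bounded, so it has a positive limit at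
  infinity (that the limit is \<open>1\<close> is irrelevant). Hence \<open>g(\<xi>) = S\<^sub>s(\<xi>) / \<xi>\<^sup>2\<close> is positive, continuous and
  \<open>O((1 + \<bar>\<xi>\<bar>) powr (2 * s - 2))\<close>, and \<open>T(r) = \<integral> g(\<xi>) * 2 * (1 - cos (r * \<xi>)) d\<xi>\<close>. As \<open>r\<close> tends to infinity
  the cosine term vanishes by the Riemann-Lebesgue lemma, leaving \<open>2 * \<integral> g\<close>; as \<open>r\<close> tends to \<open>0\<close>
  substitute \<open>\<xi> = x / r\<close> and use dominated convergence.
\<close>

section \<open>A quotient of modified Bessel functions\<close>

text \<open>
  Regularised confluent hypergeometric limit function: the modified Bessel function is
  \<open>I\<^sub>\<nu>(t) = (t / 2) powr \<nu> * hyp (\<nu> + 1) (t\<^sup>2 / 4)\<close>.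
\<close>

definition hyp :: "real \<Rightarrow> real \<Rightarrow> real" where
  "hyp c x = (\<Sum>k. rGamma (c + real k) / fact k * x ^ k)"

lemma summable_hyp:
  fixes c x :: real
  assumes "0 < c"
  shows "summable (\<lambda>k. rGamma (c + real k) / fact k * x ^ k)"
proof (rule summable_ratio_test)
  show "(1/2::real) < 1" by simp
  fix n :: nat
  \<comment> \<open>This threshold gives \<open>n \<ge> 2 * \<bar>x\<bar>\<close> and
    \<open>n \<ge> 1\<close>, so the ratio of consecutive terms,
    \<open>\<bar>x\<bar> / ((c + n) * (1 + n))\<close>, is at most \<open>1/2\<close>.\<close>
  assume n: "Suc (nat \<lceil>2 * \<bar>x\<bar>\<rceil>) \<le> n"
  have le: "2 * \<bar>x\<bar> \<le> real n" "1 \<le> real n" using n by linarith+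
  have "real n * 1 \<le> (c + real n) * (1 + real n)"
    using assms le by (intro mult_mono) auto
  hence "2 * \<bar>x\<bar> \<le> (c + real n) * (1 + real n)" using le by linarith
  hence q: "\<bar>x\<bar> / ((c + real n) * (1 + real n)) \<le> 1/2"
    using assms le by (subst pos_divide_le_eq) auto
  have e: "rGamma (c + real (Suc n)) = rGamma (c + real n) / (c + real n)"
    using rGamma_plus1[of "c + real n"] assms by (simp add: field_simps)
  have f: "(fact (Suc n) :: real) = (1 + real n) * fact n" by simp
  have "norm (rGamma (c + real (Suc n)) / fact (Suc n) * x ^ Suc n)
      = \<bar>x\<bar> / ((c + real n) * (1 + real n)) * norm (rGamma (c + real n) / fact n * x ^ n)"
    unfolding e f power_Suc using assms by (simp only: norm_mult norm_divide real_norm_def) (simp add: abs_mult mult_ac)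
  also have "\<dots> \<le> 1/2 * norm (rGamma (c + real n) / fact n * x ^ n)"
    using q by (intro mult_right_mono) auto
  finally show "norm (rGamma (c + real (Suc n)) / fact (Suc n) * x ^ Suc n)
      \<le> 1/2 * norm (rGamma (c + real n) / fact n * x ^ n)" .
qed

lemma rGamma_pos: "0 < x \<Longrightarrow> 0 < rGamma (x::real)"
  using Gamma_real_pos[of x] by (simp add: rGamma_inverse_Gamma)

text \<open>Under termwise differentiation the factor \<open>k + 1\<close> cancels against the
  factorial, and the index shift raises the parameter by one.\<close>

lemma DERIV_hyp:
  assumes "0 < c"
  shows "(hyp c has_real_derivative hyp (c + 1) x) (at x)"
proof -
  have "((\<lambda>x. \<Sum>k. rGamma (c + real k) / fact k * x ^ k) has_real_derivative
      (\<Sum>k. diffs (\<lambda>k. rGamma (c + real k) / fact k) k * x ^ k)) (at x)"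
    by (intro termdiffs_strong_converges_everywhere summable_hyp assms)
  moreover have "diffs (\<lambda>k. rGamma (c + real k) / fact k) = (\<lambda>k. rGamma (c + 1 + real k) / fact k)"
  proof
    fix k show "diffs (\<lambda>k. rGamma (c + real k) / fact k) k = rGamma (c + 1 + real k) / fact k"
      by (simp add: diffs_def add_ac del: of_nat_Suc)
        (simp add: add_ac)
  qed
  ultimately show ?thesis unfolding hyp_def[abs_def] by simp
qed

text \<open>Coefficientwise this is \<open>rGamma (c + k) = (c + k) * rGamma (c + k + 1)\<close>.
  The summand \<open>c\<close> gives the first series; the summand \<open>k\<close> kills the term
  at 0 and, after an index shift, gives the second. With \<open>DERIV_hyp\<close> it says that
  \<open>u = hyp c\<close> solves \<open>x u'' + c u' = u\<close>.\<close>

lemma hyp_rec: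
  assumes "0 < c"
  shows "hyp c x = c * hyp (c + 1) x + x * hyp (c + 2) x"
proof -
  have s1: "(\<lambda>k. rGamma (c + 1 + real k) / fact k * x ^ k) sums hyp (c + 1) x"
    and s2: "(\<lambda>k. rGamma (c + 2 + real k) / fact k * x ^ k) sums hyp (c + 2) x"
    and s0: "(\<lambda>k. rGamma (c + real k) / fact k * x ^ k) sums hyp c x"
    unfolding hyp_def using assms by (intro summable_sums summable_hyp; simp)+
  let ?f = "\<lambda>k. real k * (rGamma (c + 1 + real k) / fact k * x ^ k)"
  have "(\<lambda>k. x * (rGamma (c + 2 + real k) / fact k * x ^ k)) = (\<lambda>k. ?f (Suc k))"
  proof
    fix k
    have "rGamma (c + 1 + real (Suc k)) = rGamma (c + 2 + real k)" by (simp add: add_ac)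
    thus "x * (rGamma (c + 2 + real k) / fact k * x ^ k) = ?f (Suc k)"
      by (simp add: fact_Suc del: of_nat_Suc)
  qed
  hence "(\<lambda>k. ?f (Suc k)) sums (x * hyp (c + 2) x)"
    using sums_mult[OF s2, of x] by (simp only:)
  hence "?f sums (x * hyp (c + 2) x + ?f 0)" by (subst (asm) sums_Suc_iff)
  hence "?f sums (x * hyp (c + 2) x)" by simp
  from sums_add[OF sums_mult[OF s1, of c] this]
  have "(\<lambda>k. (c + real k) * (rGamma (c + 1 + real k) / fact k * x ^ k)) sums
      (c * hyp (c + 1) x + x * hyp (c + 2) x)"
    by (simp only: distrib_right)
  moreover have "(c + real k) * rGamma (c + 1 + real k) = rGamma (c + real k)" for k
    using rGamma_plus1[of "c + real k"] by (simp add: add_ac)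
  hence "(\<lambda>k. (c + real k) * (rGamma (c + 1 + real k) / fact k * x ^ k)) =
    (\<lambda>k. rGamma (c + real k) / fact k * x ^ k)"
    by (simp add: fun_eq_iff)
  ultimately show ?thesis using s0 sums_unique2 by metis
qed

text \<open>All terms are nonnegative, so the first two bound the series from below.\<close>

lemma hyp_ge:
  assumes "0 < c" "0 \<le> x"
  shows "rGamma c + rGamma (c + 1) * x \<le> hyp c x"
proof -
  have "(\<Sum>k<2. rGamma (c + real k) / fact k * x ^ k) \<le> hyp c x"
    unfolding hyp_def using assms
    by (intro sum_le_suminf summable_hyp ballI mult_nonneg_nonneg divide_nonneg_nonneg less_imp_le[OF rGamma_pos]) auto
  thus ?thesis by (simp add: numeral_2_eq_2)
qed

lemma hyp_pos:
  assumes "0 < c" "0 \<le> x"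
  shows "0 < hyp c x"
proof -
  have "0 < rGamma c + rGamma (c + 1) * x"
    using assms rGamma_pos[of c] rGamma_pos[of "c + 1"] by (intro add_pos_nonneg) auto
  thus ?thesis using hyp_ge[OF assms] by linarith
qed

lemma hyp_0: "hyp c 0 = rGamma c"
proof -
  have "(\<lambda>k. rGamma (c + real k) / fact k * 0 ^ k) sums (rGamma (c + real 0) / fact 0)"
    by (rule powser_sums_zero)
  thus ?thesis unfolding hyp_def by (simp add: sums_iff)
qed

lemma continuous_hyp: "0 < c \<Longrightarrow> continuous_on A (hyp c)"
  by (meson DERIV_hyp DERIV_continuous_on has_field_derivative_at_within)

text \<open>The Wronskian of the two solutions of \<open>x u'' + s u' = u\<close>, multiplied by \<open>x\<^sup>s\<close>.\<close>

lemma hyp_wronskian: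
  assumes "0 < s" "s < 1"
  shows "hyp (1 - s) x * hyp s x - x * hyp (2 - s) x * hyp (s + 1) x = rGamma (1 - s) * rGamma s"
proof -
  let ?w = "\<lambda>x. hyp (1 - s) x * hyp s x - x * hyp (2 - s) x * hyp (s + 1) x"
  have "(?w has_real_derivative 0) (at x)" for x
  proof -
    have 1: "(hyp (1 - s) has_real_derivative hyp (2 - s) x) (at x)"
      "(hyp (2 - s) has_real_derivative hyp (3 - s) x) (at x)"
      "(hyp s has_real_derivative hyp (s + 1) x) (at x)"
      "(hyp (s + 1) has_real_derivative hyp (s + 2) x) (at x)"
      using DERIV_hyp[of "1 - s" x] DERIV_hyp[of "2 - s" x] DERIV_hyp[of "s" x] DERIV_hyp[of "s + 1" x] assms
      by (simp_all add: algebra_simps)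
    \<comment> \<open>Rewriting the two factors of lowest parameter by the recurrence makes the
      derivative of \<open>?w\<close> cancel identically; the constant is then read off at
      0.\<close>
    have 2: "hyp (1 - s) x = (1 - s) * hyp (2 - s) x + x * hyp (3 - s) x"
      "hyp s x = s * hyp (s + 1) x + x * hyp (s + 2) x"
      using hyp_rec[of "1 - s" x] hyp_rec[of s x] assms by (simp_all add: algebra_simps)
    show ?thesis
      by (auto intro!: derivative_eq_intros 1) (simp add: 2 algebra_simps)
  qed
  hence "?w x = ?w 0" using DERIV_isconst_all[of ?w x 0] by blast
  thus ?thesis by (simp add: hyp_0)
qed

text \<open>\<open>bessel_ratio s (t\<^sup>2 / 4) = I\<^bsub>1-s\<^esub>(t) / I\<^bsub>s-1\<^esub>(t)\<close> for \<open>t > 0\<close>.\<close>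

definition bessel_ratio :: "real \<Rightarrow> real \<Rightarrow> real" where
  "bessel_ratio s x = x powr (1 - s) * hyp (2 - s) x / hyp s x"

text \<open>The numerator of the quotient rule is \<open>x powr (- s)\<close> times the Wronskian
  expression. The derivative is therefore positive, which gives monotonicity.\<close>

lemma DERIV_bessel_ratio:
  assumes s: "0 < s" "s < 1" and x: "0 < x"
  shows "(bessel_ratio s has_real_derivative
           rGamma (1 - s) * rGamma s * x powr (- s) / (hyp s x)\<^sup>2) (at x)"
proof -
  have 1: "(hyp (2 - s) has_real_derivative hyp (3 - s) x) (at x)"
    "(hyp s has_real_derivative hyp (s + 1) x) (at x)"
    using DERIV_hyp[of "2 - s" x] DERIV_hyp[of "s" x] s by (simp_all add: algebra_simps)
  have 2: "hyp (1 - s) x = (1 - s) * hyp (2 - s) x + x * hyp (3 - s) x"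
    using hyp_rec[of "1 - s" x] s by (simp add: algebra_simps)
  have pos: "0 < hyp s x" using hyp_pos s x by simp
  have p: "x powr (1 - s) = x * x powr (- s)"
    using x by (simp add: powr_diff powr_minus divide_simps)
  have "(bessel_ratio s has_real_derivative
      (((1 - s) * x powr (- s) * hyp (2 - s) x + x powr (1 - s) * hyp (3 - s) x) * hyp s x
        - x powr (1 - s) * hyp (2 - s) x * hyp (s + 1) x) / (hyp s x)\<^sup>2) (at x)"
    unfolding bessel_ratio_def[abs_def] using x pos
    by (auto intro!: derivative_eq_intros 1 simp: power2_eq_square)
  also have "((1 - s) * x powr (- s) * hyp (2 - s) x + x powr (1 - s) * hyp (3 - s) x) * hyp s x
        - x powr (1 - s) * hyp (2 - s) x * hyp (s + 1) x
      = x powr (- s) * (hyp (1 - s) x * hyp s x - x * hyp (2 - s) x * hyp (s + 1) x)"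
    unfolding 2 p by (simp add: algebra_simps)
  also have "hyp (1 - s) x * hyp s x - x * hyp (2 - s) x * hyp (s + 1) x = rGamma (1 - s) * rGamma s"
    by (rule hyp_wronskian[OF s])
  finally show ?thesis by (simp add: mult_ac)
qed

lemma bessel_ratio_pos:
  assumes "0 < s" "s < 1" "0 < x" shows "0 < bessel_ratio s x"
  unfolding bessel_ratio_def using assms by (intro divide_pos_pos mult_pos_pos hyp_pos) auto

lemma bessel_ratio_mono:
  assumes "0 < s" "s < 1" "0 < x" "x \<le> y" shows "bessel_ratio s x \<le> bessel_ratio s y"
proof (rule DERIV_nonneg_imp_nondecreasing[OF assms(4)])
  fix z assume z: "x \<le> z" "z \<le> y"
  have "0 \<le> rGamma (1 - s) * rGamma s * z powr (- s) / (hyp s z)\<^sup>2"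
    using assms rGamma_pos[of s] rGamma_pos[of "1 - s"] by simp
  thus "\<exists>d. (bessel_ratio s has_real_derivative d) (at z) \<and> 0 \<le> d"
    using DERIV_bessel_ratio[of s z] assms z by force
qed

text \<open>
  The derivative of the ratio is \<open>O(x powr (-s-2))\<close> because \<open>hyp s\<close> grows at least linearly.
\<close>

lemma bessel_ratio_bounded:
  assumes s: "0 < s" "s < 1"
  obtains P where "\<And>x. 0 < x \<Longrightarrow> bessel_ratio s x \<le> P"
proof -
  define W where "W = rGamma (1 - s) * rGamma s"
  define D where "D = W / ((s + 1) * (rGamma (s + 1))\<^sup>2)"
  have W: "0 < W" unfolding W_def using s by (intro mult_pos_pos rGamma_pos) auto
  have r: "0 < rGamma (s + 1)" using s by (intro rGamma_pos) auto
  have D: "0 < D" unfolding D_def using W r s by simp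
  \<comment> \<open>\<open>D\<close> is chosen so that the added term has derivative
    \<open>- W * x powr (- s) / (rGamma (s + 1) * x)\<^sup>2\<close>. This outweighs the derivative
    of the ratio, so \<open>q\<close> is nonincreasing from 1 on and \<open>q 1\<close> serves as
    the bound.\<close>
  define q where "q = (\<lambda>x. bessel_ratio s x + D * x powr (- s - 1))"
  have q: "q x \<le> q 1" if "1 \<le> x" for x
  proof (rule DERIV_nonpos_imp_nonincreasing[OF that])
    fix z :: real assume z: "1 \<le> z" "z \<le> x"
    have "rGamma (s + 1) * z \<le> hyp s z"
      using hyp_ge[of s z] rGamma_pos[of s] s z by simp
    hence "(rGamma (s + 1) * z)\<^sup>2 \<le> (hyp s z)\<^sup>2" using r z by (intro power_mono) auto
    hence "W * z powr (- s) / (hyp s z)\<^sup>2 \<le> W * z powr (- s) / (rGamma (s + 1) * z)\<^sup>2"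
      using W r z hyp_pos[of s z] s
      by (intro divide_left_mono mult_nonneg_nonneg mult_pos_pos zero_less_power) auto
    also have "\<dots> = D * (s + 1) * z powr (- s - 1 - 1)"
    proof -
      have "z powr (- s - 1 - 1) = z powr (- s) / z\<^sup>2"
        using z by (simp only: powr_diff) (simp add: power2_eq_square)
      thus ?thesis using s z r by (simp add: D_def power_mult_distrib)
    qed
    finally have "W * z powr (- s) / (hyp s z)\<^sup>2 + D * ((- s - 1) * z powr (- s - 1 - 1)) \<le> 0"
      by (simp add: algebra_simps)
    moreover have "(q has_real_derivative
        (W * z powr (- s) / (hyp s z)\<^sup>2 + D * ((- s - 1) * z powr (- s - 1 - 1)))) (at z)"
      unfolding q_def W_def using z
      by (auto intro!: derivative_eq_intros DERIV_bessel_ratio s)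
    ultimately show "\<exists>d. (q has_real_derivative d) (at z) \<and> d \<le> 0" by blast
  qed
  have "bessel_ratio s x \<le> q 1" if "0 < x" for x
  proof -
    have "bessel_ratio s x \<le> bessel_ratio s (max 1 x)"
      using that by (intro bessel_ratio_mono s) auto
    also have "\<dots> \<le> q (max 1 x)" using D by (simp add: q_def)
    also have "\<dots> \<le> q 1" by (rule q) auto
    finally show ?thesis .
  qed
  thus ?thesis using that by blast
qed

lemma bessel_ratio_limit:
  assumes s: "0 < s" "s < 1"
  obtains L where "0 < L" "(bessel_ratio s \<longlongrightarrow> L) at_top"
proof -
  obtain P where P: "\<And>x. 0 < x \<Longrightarrow> bessel_ratio s x \<le> P"
    using bessel_ratio_bounded[OF s] by blast
  \<comment> \<open>Freezing the argument below 1 gives a function that is monotone on the whole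
    line, so convergence along the integers implies convergence at infinity.\<close>
  let ?p = "\<lambda>x. bessel_ratio s (max 1 x)"
  have mono: "mono ?p" using s by (intro monoI bessel_ratio_mono) auto
  have "incseq (\<lambda>n. ?p (real n))" using mono by (simp add: incseq_def mono_def)
  then obtain L where L: "(\<lambda>n. ?p (real n)) \<longlonglongrightarrow> L" "\<forall>n. ?p (real n) \<le> L"
    using incseq_convergent[of "\<lambda>n. ?p (real n)" P] P by (metis less_max_iff_disj zero_less_one)
  have "(?p \<longlongrightarrow> L) at_top"
    by (rule tendsto_at_topI_sequentially_real[OF mono L(1)])
  moreover have "eventually (\<lambda>x. ?p x = bessel_ratio s x) at_top"
    using eventually_ge_at_top[of 1] by eventually_elim auto
  ultimately have "(bessel_ratio s \<longlongrightarrow> L) at_top" by (rule Lim_transform_eventually)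
  moreover have "0 < L" using L(2)[rule_format, of 0] bessel_ratio_pos[OF s, of 1] by simp
  ultimately show ?thesis using that by blast
qed

section \<open>The symbol\<close>

text \<open>The symbol divided by \<open>\<xi>\<^sup>2\<close>. The powers of
  \<open>\<bar>\<xi>\<bar>\<close> cancel, so this form is continuous and positive at 0 as
  well.\<close>

definition red_symb :: "real \<Rightarrow> real \<Rightarrow> real" where
  "red_symb s \<xi> = Gamma (1 - s) / (2 * Gamma s) * (hyp (2 - s) (\<xi>\<^sup>2 / 4) / hyp s (\<xi>\<^sup>2 / 4))"

text \<open>Since \<open>Ln (- \<i>) = - \<i> * pi / 2\<close>, the principal power contributes only
  the phase. In the series the sign of \<open>(- \<i> * t / 2) ^ (2 * k)\<close> cancels
  \<open>(- 1) ^ k\<close>, which turns J into the modified function I.\<close>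

lemma bessel_J_neg_imag:
  assumes "0 < \<nu> + 1" "0 < t"
  shows "bessel_J (of_real \<nu>) (- \<i> * of_real t)
    = exp (- \<i> * of_real (pi * \<nu> / 2)) * of_real ((t / 2) powr \<nu> * hyp (\<nu> + 1) (t\<^sup>2 / 4))"
proof -
  have z: "- \<i> * of_real t / 2 = of_real (t / 2) * (- \<i>)" by simp
  have L: "Ln (- \<i> * of_real t / 2) = of_real (ln (t / 2)) + Ln (- \<i>)"
  proof -
    have t: "0 < t / 2" and i: "- \<i> \<noteq> 0" using assms by auto
    show ?thesis unfolding z Ln_times_of_real[OF t i] Ln_of_real[OF t] ..
  qed
  have ln: "of_real \<nu> * Ln (- \<i> * of_real t / 2)
      = of_real (\<nu> * ln (t / 2)) + (- \<i> * of_real (pi * \<nu> / 2))"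
    unfolding L Ln_minus_ii by (simp add: complex_eq_iff)
  have "- \<i> * of_real t / 2 \<noteq> 0" using assms by simp
  hence "(- \<i> * of_real t / 2) powr (of_real \<nu>)
      = exp (of_real (\<nu> * ln (t / 2)) + (- \<i> * of_real (pi * \<nu> / 2)))"
    unfolding powr_def ln by (rule if_not_P)
  also have "\<dots> = of_real ((t / 2) powr \<nu>) * exp (- \<i> * of_real (pi * \<nu> / 2))"
    using assms unfolding exp_add exp_of_real by (simp add: powr_def)
  finally have 1: "(- \<i> * of_real t / 2) powr (of_real \<nu>)
      = of_real ((t / 2) powr \<nu>) * exp (- \<i> * of_real (pi * \<nu> / 2))" .
  have 2: "(- 1) ^ k * rGamma (of_real \<nu> + of_nat k + 1) / fact k * (- \<i> * of_real t / 2) ^ (2 * k)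
      = of_real (rGamma (\<nu> + 1 + real k) / fact k * (t\<^sup>2 / 4) ^ k)" for k
  proof -
    have "(- \<i> * of_real t / 2)\<^sup>2 = - of_real (t\<^sup>2 / 4)"
      by (simp add: power_divide power_mult_distrib)
    hence e: "(- \<i> * of_real t / 2) ^ (2 * k) = (- 1) ^ k * of_real ((t\<^sup>2 / 4) ^ k)"
      unfolding power_mult by (simp only: power_minus[of "of_real (t\<^sup>2 / 4)" k] of_real_power)
    have g: "rGamma (of_real \<nu> + of_nat k + 1) = complex_of_real (rGamma (\<nu> + 1 + real k))"
      by (simp add: rGamma_complex_of_real[symmetric] add_ac)
    have "(- 1) ^ k * (- 1) ^ k = (1 :: complex)"
      by (simp flip: power_add mult_2)
    hence "(- 1) ^ k * x / y * ((- 1) ^ k * z) = x / y * z" for x y z :: complex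
      by (metis mult.assoc mult.commute mult_1 times_divide_eq_right)
    thus ?thesis unfolding e g by simp
  qed
  show ?thesis
    unfolding bessel_J_def 1 2 hyp_def
    using suminf_of_real[OF summable_hyp[OF assms(1)], where ?'a=complex, of "t\<^sup>2/4"] by simp
qed

text \<open>The base \<open>(1 - \<i>) / 2\<close> has modulus \<open>1 / sqrt 2\<close> and
  argument \<open>- pi / 4\<close>. Its power is thus
  \<open>2 powr (1 - 2 * s) * exp (- \<i> * pi * s) * \<i>\<close>, and the two factors
  \<open>\<i>\<close> give the minus sign.\<close>

lemma c1_eq:
  "c1 s = - exp (- \<i> * of_real (pi * s)) * of_real (2 powr (1 - 2 * s) * Gamma (1 - s) / Gamma s)"
proof -
  have ex: "exp (- of_real (ln 2 / 2) - \<i> * of_real (pi / 4)) = (1 - \<i>) / 2"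
  proof -
    have e: "exp (- (ln 2 / 2)) = 1 / sqrt 2"
      by (simp add: exp_minus ln_sqrt[symmetric] field_simps)
    show ?thesis
      by (rule complex_eqI) (simp_all add: Re_exp Im_exp e cos_45 sin_45 real_div_sqrt field_simps)
  qed
  have ei: "exp (\<i> * of_real (pi / 2)) = \<i>"
    by (rule complex_eqI) (simp_all add: Re_exp Im_exp)
  have "Ln (exp (- of_real (ln 2 / 2) - \<i> * of_real (pi / 4)))
      = - of_real (ln 2 / 2) - \<i> * of_real (pi / 4)"
  proof (rule Ln_exp)
    have "Im (- of_real (ln 2 / 2) - \<i> * of_real (pi / 4)) = - (pi / 4)" by simp
    thus "- pi < Im (- of_real (ln 2 / 2) - \<i> * of_real (pi / 4))"
      "Im (- of_real (ln 2 / 2) - \<i> * of_real (pi / 4)) \<le> pi"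
      using pi_gt_zero by linarith+
  qed
  hence "Ln ((1 - \<i>) / 2) = - of_real (ln 2 / 2) - \<i> * of_real (pi / 4)"
    unfolding ex .
  moreover have "(1 - \<i>) / 2 \<noteq> 0" by (simp add: complex_eq_iff)
  ultimately have "((1 - \<i>) / 2) powr of_real (4 * s - 2)
      = exp (of_real (4 * s - 2) * (- of_real (ln 2 / 2) - \<i> * of_real (pi / 4)))"
    unfolding powr_def by (simp only: if_False)
  also have "of_real (4 * s - 2) * (- of_real (ln 2 / 2) - \<i> * of_real (pi / 4))
      = of_real ((1 - 2 * s) * ln 2) + - \<i> * of_real (pi * s) + \<i> * of_real (pi / 2)"
    by (simp add: complex_eq_iff algebra_simps)
  also have "exp \<dots> = of_real (2 powr (1 - 2 * s)) * exp (- \<i> * of_real (pi * s)) * \<i>"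
    unfolding exp_add exp_of_real ei by (simp add: powr_def)
  finally have p: "((1 - \<i>) / 2) powr of_real (4 * s - 2)
      = of_real (2 powr (1 - 2 * s)) * exp (- \<i> * of_real (pi * s)) * \<i>" .
  have alg: "\<i> * (a * b * \<i>) * c = - b * (a * c)" for a b c :: complex
  proof -
    have "\<i> * (a * b * \<i>) * c = (\<i> * \<i>) * (b * (a * c))" by (simp only: mult_ac)
    thus ?thesis by simp
  qed
  have "c1 s = - exp (- \<i> * of_real (pi * s))
      * (of_real (2 powr (1 - 2 * s)) * of_real (Gamma (1 - s) / Gamma s))"
    unfolding c1_def p by (rule alg)
  also have "of_real (2 powr (1 - 2 * s)) * of_real (Gamma (1 - s) / Gamma s)
      = complex_of_real (2 powr (1 - 2 * s) * Gamma (1 - s) / Gamma s)" by simp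
  finally show ?thesis .
qed

text \<open>By \<open>e1\<close> the phases of \<open>c1\<close> and of the numerator multiply to
  minus the phase of the denominator, and this sign cancels the one in \<open>c1_eq\<close>. By
  \<open>r\<close> the powers of 2 and of \<open>t\<close> collect to
  \<open>t\<^sup>2 / 2\<close>.\<close>

lemma symb_eq:
  assumes s: "0 < s" "s < 1" and "\<xi> \<noteq> 0"
  shows "symb s \<xi> = of_real (red_symb s \<xi> * \<xi>\<^sup>2)"
proof -
  define t where "t = \<bar>\<xi>\<bar>"
  have t: "0 < t" "t\<^sup>2 = \<xi>\<^sup>2" using assms by (auto simp: t_def)
  have J1: "bessel_J (of_real (1 - s)) (- \<i> * of_real t)
      = exp (- \<i> * of_real (pi * (1 - s) / 2)) * of_real ((t / 2) powr (1 - s) * hyp (2 - s) (t\<^sup>2 / 4))"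
    using bessel_J_neg_imag[of "1 - s" t] s t by simp
  have J2: "bessel_J (of_real (s - 1)) (- \<i> * of_real t)
      = exp (- \<i> * of_real (pi * (s - 1) / 2)) * of_real ((t / 2) powr (s - 1) * hyp s (t\<^sup>2 / 4))"
    using bessel_J_neg_imag[of "s - 1" t] s t by simp
  have e1: "exp (- \<i> * of_real (pi * s)) * exp (- \<i> * of_real (pi * (1 - s) / 2))
      = - exp (- \<i> * of_real (pi * (s - 1) / 2))"
  proof -
    have "- \<i> * of_real (pi * s) + - \<i> * of_real (pi * (1 - s) / 2)
      = - (of_real pi * \<i>) + - \<i> * of_real (pi * (s - 1) / 2)"
      by (simp add: complex_eq_iff field_simps)
    thus ?thesis by (simp only: exp_add[symmetric]) (simp only: exp_add exp_minus exp_pi_i, simp)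
  qed
  have r: "2 powr (1 - 2 * s) * Gamma (1 - s) / Gamma s
      * ((t / 2) powr (1 - s) * hyp (2 - s) (t\<^sup>2 / 4) / ((t / 2) powr (s - 1) * hyp s (t\<^sup>2 / 4)))
      * t powr (2 * s) = red_symb s \<xi> * \<xi>\<^sup>2"
  proof -
    have "2 powr (1 - 2 * s) * ((t / 2) powr (1 - s) / (t / 2) powr (s - 1)) * t powr (2 * s)
      = exp ((1 - 2 * s) * ln 2 + (1 - s) * (ln t - ln 2) - (s - 1) * (ln t - ln 2) + 2 * s * ln t)"
      using t by (simp add: powr_def ln_div exp_add exp_diff)
    also have "(1 - 2 * s) * ln 2 + (1 - s) * (ln t - ln 2) - (s - 1) * (ln t - ln 2) + 2 * s * ln t
      = ln t + ln t - ln 2" by (simp add: algebra_simps)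
    also have "exp \<dots> = t\<^sup>2 / 2"
      using t(1) unfolding exp_diff exp_add by (simp add: power2_eq_square)
    finally have "2 powr (1 - 2 * s) * ((t / 2) powr (1 - s) / (t / 2) powr (s - 1)) * t powr (2 * s) = t\<^sup>2 / 2" .
    moreover have "2 powr (1 - 2 * s) * Gamma (1 - s) / Gamma s
      * ((t / 2) powr (1 - s) * hyp (2 - s) (t\<^sup>2 / 4) / ((t / 2) powr (s - 1) * hyp s (t\<^sup>2 / 4)))
      * t powr (2 * s) =
      (2 powr (1 - 2 * s) * ((t / 2) powr (1 - s) / (t / 2) powr (s - 1)) * t powr (2 * s))
      * (Gamma (1 - s) / Gamma s * (hyp (2 - s) (t\<^sup>2 / 4) / hyp s (t\<^sup>2 / 4)))"
      by (simp add: mult_ac)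
    ultimately have "2 powr (1 - 2 * s) * Gamma (1 - s) / Gamma s
      * ((t / 2) powr (1 - s) * hyp (2 - s) (t\<^sup>2 / 4) / ((t / 2) powr (s - 1) * hyp s (t\<^sup>2 / 4)))
      * t powr (2 * s) = t\<^sup>2 / 2 * (Gamma (1 - s) / Gamma s * (hyp (2 - s) (t\<^sup>2 / 4) / hyp s (t\<^sup>2 / 4)))"
      by (simp only:)
    also have "\<dots> = red_symb s \<xi> * \<xi>\<^sup>2" unfolding red_symb_def t(2) by (simp add: mult_ac)
    finally show ?thesis .
  qed
  have alg: "(- a * of_real A) * (b * of_real B / (c * of_real C)) * of_real E
      = of_real (A * (B / C) * E)" if "a * b = - c" "c \<noteq> 0" for a b c :: complex and A B C E :: real
  proof -
    have "(- a * of_real A) * (b * of_real B / (c * of_real C)) * of_real E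
      = (- (a * b) / c) * of_real (A * (B / C) * E)" by simp
    also have "- (a * b) / c = 1" using that by simp
    finally show ?thesis by simp
  qed
  show ?thesis
    unfolding symb_def t_def[symmetric] J1 J2 c1_eq r[symmetric] by (rule alg[OF e1]) simp
qed

section \<open>Integrals on the line\<close>

text \<open>\<open>1 + \<bar>x\<bar>\<close> is at most 2 in the first case and at most
  \<open>2 * \<bar>x\<bar>\<close> in the second, and a nonpositive exponent reverses the
  inequality. Bounds near 0 and near infinity are thereby merged into one weight.\<close>

lemma weight_bounds:
  fixes x e :: real
  assumes "e \<le> 0"
  shows "\<bar>x\<bar> \<le> 1 \<Longrightarrow> 1 \<le> 2 powr (- e) * (1 + \<bar>x\<bar>) powr e"
    and "1 \<le> \<bar>x\<bar> \<Longrightarrow> \<bar>x\<bar> powr e \<le> 2 powr (- e) * (1 + \<bar>x\<bar>) powr e"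
proof -
  assume "\<bar>x\<bar> \<le> 1"
  hence "2 powr e \<le> (1 + \<bar>x\<bar>) powr e" using assms by (intro powr_mono2') auto
  hence "2 powr (- e) * 2 powr e \<le> 2 powr (- e) * (1 + \<bar>x\<bar>) powr e" by (intro mult_left_mono) auto
  thus "1 \<le> 2 powr (- e) * (1 + \<bar>x\<bar>) powr e" by (simp flip: powr_add)
next
  assume "1 \<le> \<bar>x\<bar>"
  hence "(2 * \<bar>x\<bar>) powr e \<le> (1 + \<bar>x\<bar>) powr e" using assms by (intro powr_mono2') auto
  hence "2 powr (- e) * (2 * \<bar>x\<bar>) powr e \<le> 2 powr (- e) * (1 + \<bar>x\<bar>) powr e" by (intro mult_left_mono) auto
  moreover have "2 powr (- e) * (2 * \<bar>x\<bar>) powr e = \<bar>x\<bar> powr e"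
    by (simp add: powr_mult powr_minus)
  ultimately show "\<bar>x\<bar> powr e \<le> 2 powr (- e) * (1 + \<bar>x\<bar>) powr e" by simp
qed

text \<open>Makes the weight comparable with its small translates, uniformly in
  \<open>x\<close>.\<close>

lemma half_weight_translate: "\<bar>h\<bar> \<le> 1/2 \<Longrightarrow> (1 + \<bar>x\<bar>) / 2 \<le> 1 + \<bar>h + x\<bar>" for h x :: real
  by (cases "0 \<le> x"; cases "0 \<le> h + x"; simp)

lemma integrable_weight:
  fixes e :: real
  assumes "e < - 1"
  shows "integrable lborel (\<lambda>x. (1 + \<bar>x\<bar>) powr e)"
proof -
  let ?f = "\<lambda>x::real. (1 + \<bar>x\<bar>) powr e * indicator {0..} x"
  have "((\<lambda>x::real. (1 + x) powr (e + 1) / (e + 1)) \<longlongrightarrow> 0 / (e + 1)) at_top"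
    using assms
    by (intro tendsto_divide tendsto_const tendsto_neg_powr filterlim_tendsto_add_at_top[OF tendsto_const] filterlim_ident) auto
  hence "(\<integral>\<^sup>+x. ennreal ((1 + x) powr e) * indicator {0..} x \<partial>lborel)
      = 0 / (e + 1) - (1 + 0) powr (e + 1) / (e + 1)"
    using assms by (intro nn_integral_FTC_atLeast) (auto intro!: derivative_eq_intros)
  moreover have "(\<integral>\<^sup>+x. ennreal ((1 + x) powr e) * indicator {0..} x \<partial>lborel)
      = (\<integral>\<^sup>+x. ennreal (norm (?f x)) \<partial>lborel)"
    by (intro nn_integral_cong) (auto simp: indicator_def)
  ultimately have f: "integrable lborel ?f"
    by (intro integrableI_bounded) (auto simp: ennreal_less_top)
  hence "integrable lborel (\<lambda>x. ?f (0 + (-1) * x))" by (rule lborel_integrable_real_affine) simp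
  \<comment> \<open>The two half-line functions overlap at 0, so their sum is a majorant of the
    weight rather than equal to it.\<close>
  from Bochner_Integration.integrable_add[OF f this] show ?thesis
    by (rule Bochner_Integration.integrable_bound) (auto simp: indicator_def)
qed

text \<open>
  Translating by half a period \<open>\<pi> / r\<close> changes the sign of \<open>cos (r * x)\<close>, so the integral is
  controlled by the \<open>L\<^sup>1\<close> modulus of continuity of \<open>g\<close>.
\<close>

lemma Riemann_Lebesgue_cos:
  fixes g :: "real \<Rightarrow> real"
  assumes cont: "continuous_on UNIV g" and e: "e < - 1"
    and g: "\<And>x. \<bar>g x\<bar> \<le> C * (1 + \<bar>x\<bar>) powr e"
  shows "((\<lambda>r. LINT x|lborel. g x * cos (r * x)) \<longlongrightarrow> 0) at_top"
proof -
  have [measurable]: "g \<in> borel_measurable borel"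
    using cont by (rule borel_measurable_continuous_onI)
  have C: "0 \<le> C" using g[of 0] by simp
  have int_g: "integrable lborel g"
  proof (rule Bochner_Integration.integrable_bound)
    show "integrable lborel (\<lambda>x. C * (1 + \<bar>x\<bar>) powr e)"
      using integrable_weight[OF e] by simp
    show "AE x in lborel. norm (g x) \<le> norm (C * (1 + \<bar>x\<bar>) powr e)"
      using g C by simp
  qed measurable
  have int: "integrable lborel (\<lambda>x. g x * cos (a * x))" for a
    using int_g by (rule Bochner_Integration.integrable_bound) (auto simp: abs_mult mult_left_le)
  have int': "integrable lborel (\<lambda>x. g (h + x) * cos (a * x))" for a h
    by (rule Bochner_Integration.integrable_bound[where f="\<lambda>x. g (h + x)"])
      (use lborel_integrable_real_affine[OF int_g, of 1 h] in \<open>auto simp: abs_mult mult_left_le\<close>)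
  have half: "(LINT x|lborel. g x * cos (r * x)) = (LINT x|lborel. (g x - g (pi / r + x)) * cos (r * x)) / 2"
    if "0 < r" for r
  proof -
    have "(LINT x|lborel. g x * cos (r * x)) = (LINT x|lborel. g (pi / r + x) * cos (r * (pi / r + x)))"
      using lborel_integral_real_affine[of 1 "\<lambda>x. g x * cos (r * x)" "pi / r"] by simp
    also have "(\<lambda>x. g (pi / r + x) * cos (r * (pi / r + x))) = (\<lambda>x. - (g (pi / r + x) * cos (r * x)))"
      using that by (simp add: distrib_left cos_add)
    finally have "(LINT x|lborel. g x * cos (r * x)) = - (LINT x|lborel. g (pi / r + x) * cos (r * x))"
      by simp
    moreover have "(LINT x|lborel. (g x - g (pi / r + x)) * cos (r * x))
        = (LINT x|lborel. g x * cos (r * x)) - (LINT x|lborel. g (pi / r + x) * cos (r * x))"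
      unfolding left_diff_distrib using int int' by (intro Bochner_Integration.integral_diff)
    ultimately show ?thesis by simp
  qed
  \<comment> \<open>Continuity of \<open>g\<close> gives pointwise convergence of the difference to
    0. In the dominating function \<open>C\<close> accounts for \<open>g x\<close> and
    \<open>C * 2 powr (- e)\<close> for the translate.\<close>
  have "((\<lambda>r. LINT x|lborel. (g x - g (pi / r + x)) * cos (r * x)) \<longlongrightarrow> integral\<^sup>L lborel (\<lambda>x::real. 0::real)) at_top"
  proof (rule integral_dominated_convergence_at_top)
    show "integrable lborel (\<lambda>x. (C + C * 2 powr (- e)) * (1 + \<bar>x\<bar>) powr e)"
      using integrable_weight[OF e] by simp
    show "AE x in lborel. ((\<lambda>r. (g x - g (pi / r + x)) * cos (r * x)) \<longlongrightarrow> 0) at_top"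
    proof (rule AE_I2)
      fix x
      have "((\<lambda>r. pi / r + x) \<longlongrightarrow> 0 + x) at_top"
        by (intro tendsto_add tendsto_const real_tendsto_divide_at_top[OF tendsto_const] filterlim_ident)
      moreover have "isCont g x" using cont by (simp add: continuous_on_eq_continuous_at)
      ultimately have "((\<lambda>r. g (pi / r + x)) \<longlongrightarrow> g x) at_top"
        using isCont_tendsto_compose by force
      hence "((\<lambda>r. g x - g (pi / r + x)) \<longlongrightarrow> g x - g x) at_top"
        by (intro tendsto_diff tendsto_const)
      hence 0: "((\<lambda>r. \<bar>g x - g (pi / r + x)\<bar>) \<longlongrightarrow> 0) at_top"
        by (simp add: tendsto_rabs_zero)
      show "((\<lambda>r. (g x - g (pi / r + x)) * cos (r * x)) \<longlongrightarrow> 0) at_top"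
        by (rule Lim_null_comparison[OF _ 0]) (auto simp: abs_mult mult_left_le intro!: always_eventually)
    qed
    show "\<forall>\<^sub>F r in at_top. AE x in lborel. norm ((g x - g (pi / r + x)) * cos (r * x))
        \<le> (C + C * 2 powr (- e)) * (1 + \<bar>x\<bar>) powr e"
      \<comment> \<open>From \<open>2 * pi\<close> on, the shift \<open>pi / r\<close> is at most
        \<open>1/2\<close>, as \<open>half_weight_translate\<close> requires.\<close>
      using eventually_ge_at_top[of "2 * pi"]
    proof eventually_elim
      case (elim r)
      hence r: "0 < r" using pi_gt_zero by linarith
      have pr: "0 \<le> pi / r" "pi / r \<le> 1/2" using r elim by (auto simp: field_simps)
      show ?case
      proof (rule AE_I2)
        fix x
        have "\<bar>g (pi / r + x)\<bar> \<le> C * (1 + \<bar>pi / r + x\<bar>) powr e" by (rule g)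
        also have "(1 + \<bar>x\<bar>) / 2 \<le> 1 + \<bar>pi / r + x\<bar>"
          using half_weight_translate[of "pi / r" x] pr by simp
        hence "C * (1 + \<bar>pi / r + x\<bar>) powr e \<le> C * ((1 + \<bar>x\<bar>) / 2) powr e"
          using C e by (intro mult_left_mono powr_mono2') auto
        also have "((1 + \<bar>x\<bar>) / 2) powr e = 2 powr (- e) * (1 + \<bar>x\<bar>) powr e"
          by (simp add: powr_divide powr_minus divide_simps)
        finally have "\<bar>g (pi / r + x)\<bar> \<le> C * (2 powr (- e) * (1 + \<bar>x\<bar>) powr e)" .
        hence "\<bar>g x - g (pi / r + x)\<bar> \<le> (C + C * 2 powr (- e)) * (1 + \<bar>x\<bar>) powr e"
          using g[of x] by (simp add: distrib_right)
        moreover have "\<bar>(g x - g (pi / r + x)) * cos (r * x)\<bar> \<le> \<bar>g x - g (pi / r + x)\<bar>"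
          by (simp add: abs_mult mult_left_le)
        ultimately show "norm ((g x - g (pi / r + x)) * cos (r * x))
            \<le> (C + C * 2 powr (- e)) * (1 + \<bar>x\<bar>) powr e" by simp
      qed
    qed
  qed measurable
  hence "((\<lambda>r. (LINT x|lborel. (g x - g (pi / r + x)) * cos (r * x)) / 2) \<longlongrightarrow> 0 / 2) at_top"
    by (intro tendsto_divide tendsto_const) auto
  moreover have "\<forall>\<^sub>F r in at_top. (LINT x|lborel. (g x - g (pi / r + x)) * cos (r * x)) / 2
      = (LINT x|lborel. g x * cos (r * x))"
    using eventually_gt_at_top[of 0] by eventually_elim (simp add: half)
  ultimately show ?thesis by (simp add: Lim_transform_eventually)
qed

text \<open>A zero integral would force \<open>f = 0\<close> almost everywhere, but the interval has
  positive measure.\<close>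

lemma lborel_integral_pos:
  fixes f :: "real \<Rightarrow> real"
  assumes "integrable lborel f" "\<And>x. 0 \<le> f x" "a < b" "\<And>x. a < x \<Longrightarrow> x < b \<Longrightarrow> 0 < f x"
  shows "0 < integral\<^sup>L lborel f"
proof -
  have "integral\<^sup>L lborel f \<noteq> 0"
  proof
    assume "integral\<^sup>L lborel f = 0"
    hence "AE x in lborel. f x = 0"
      using integral_nonneg_eq_0_iff_AE[OF assms(1)] assms(2) by simp
    hence "AE x in lborel. x \<notin> {a<..<b}"
      by eventually_elim (use assms(4) in force)
    hence "emeasure lborel {a<..<b} = 0"
      by (subst (asm) AE_iff_null_sets[symmetric]) auto
    thus False using assms(3) by simp
  qed
  moreover have "0 \<le> integral\<^sup>L lborel f" using assms(2) by simp
  ultimately show ?thesis by simp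
qed

section \<open>Fourier transforms of indicators of intervals\<close>

text \<open>Integrating the exponential gives \<open>\<bar>exp (- \<i> * r * \<xi>) -
  1\<bar>\<^sup>2 = 2 * (1 - cos (r * \<xi>))\<close>. The factor \<open>\<xi>\<^sup>2\<close>
  stands on the left so that \<open>\<xi> = 0\<close> is covered, where both sides vanish.\<close>

lemma cmod_fourier_indicator:
  assumes "0 \<le> r"
  shows "(cmod (fourier (indicator {0..r}) \<xi>))\<^sup>2 * \<xi>\<^sup>2 = 2 * (1 - cos (r * \<xi>))"
proof (cases "\<xi> = 0")
  case False
  let ?F = "\<lambda>x::real. \<i> / of_real \<xi> * exp (- \<i> * of_real x * of_real \<xi>)"
  have "fourier (indicator {0..r}) \<xi>
      = (LINT x|lborel. indicator {0..r} x *\<^sub>R exp (- \<i> * of_real x * of_real \<xi>))"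
    unfolding fourier_def
    by (intro Bochner_Integration.integral_cong) (auto simp: indicator_def)
  also have "\<dots> = ?F r - ?F 0"
  proof (rule integral_FTC_atLeastAtMost[OF assms])
    fix x
    have "((\<lambda>z. \<i> / of_real \<xi> * exp (- \<i> * z * of_real \<xi>)) has_field_derivative
        exp (- \<i> * of_real x * of_real \<xi>)) (at (of_real x))"
      using False by (auto intro!: derivative_eq_intros)
    thus "(?F has_vector_derivative exp (- \<i> * of_real x * of_real \<xi>)) (at x within {0..r})"
      by (rule has_vector_derivative_at_within[OF has_vector_derivative_real_field])
  qed (intro continuous_intros)
  also have "\<dots> = \<i> / of_real \<xi> * (exp (\<i> * of_real (- r * \<xi>)) - 1)"
    by (simp add: algebra_simps)
  finally have "(cmod (fourier (indicator {0..r}) \<xi>))\<^sup>2 = (cmod (exp (\<i> * of_real (- r * \<xi>)) - 1))\<^sup>2 / \<xi>\<^sup>2"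
    by (simp add: norm_mult norm_divide power_mult_distrib power_divide)
  also have "(cmod (exp (\<i> * of_real (- r * \<xi>)) - 1))\<^sup>2 = (cos (r * \<xi>) - 1)\<^sup>2 + (sin (r * \<xi>))\<^sup>2"
    unfolding cmod_power2 by (simp add: Re_exp Im_exp)
  also have "\<dots> = 2 * (1 - cos (r * \<xi>))"
    using sin_cos_squared_add[of "r * \<xi>"] by (simp add: power2_diff)
  finally show ?thesis using False by simp
qed auto

lemma fourier_translate:
  "cmod (fourier (\<lambda>x. u (x - a)) \<xi>) = cmod (fourier u \<xi>)"
proof -
  have "fourier (\<lambda>x. u (x - a)) \<xi>
      = (LINT x|lborel. u x * exp (- \<i> * of_real (a + x) * of_real \<xi>))"
    unfolding fourier_def
    using lborel_integral_real_affine[of 1 "\<lambda>x. u (x - a) * exp (- \<i> * of_real x * of_real \<xi>)" a] by simp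
  also have "\<dots> = (LINT x|lborel. exp (\<i> * of_real (- a * \<xi>)) * (u x * exp (- \<i> * of_real x * of_real \<xi>)))"
  proof (rule Bochner_Integration.integral_cong[OF refl])
    fix x
    have "- \<i> * of_real (a + x) * of_real \<xi> = \<i> * of_real (- a * \<xi>) + - \<i> * of_real x * of_real \<xi>"
      by (simp add: algebra_simps)
    thus "u x * exp (- \<i> * of_real (a + x) * of_real \<xi>)
        = exp (\<i> * of_real (- a * \<xi>)) * (u x * exp (- \<i> * of_real x * of_real \<xi>))"
      by (simp only: exp_add mult_ac)
  qed
  also have "\<dots> = exp (\<i> * of_real (- a * \<xi>)) * fourier u \<xi>"
    unfolding fourier_def by (rule integral_mult_right_zero)
  finally show ?thesis by (simp only: norm_mult norm_exp_i_times mult_1)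
qed

text \<open>Finite length bounds a nonempty \<open>I\<close>, so \<open>I\<close> lies between the
  open and the closed interval with endpoints \<open>Inf I\<close> and \<open>Sup I\<close>; these
  differ by a null set.\<close>

lemma connected_finite_measure_real:
  fixes I :: "real set"
  assumes I: "connected I" and r: "0 \<le> r" "emeasure lborel I = ennreal r"
  obtains a where "AE x in lborel. x \<in> I \<longleftrightarrow> x \<in> {a..a + r}" "I \<in> sets borel"
proof -
  have meas: "I \<in> sets borel"
    using I by (intro real_interval_borel_measurable) (simp add: is_interval_connected_1)
  show ?thesis
  proof (cases "I = {}")
    case True
    hence "r = 0" using r by simp
    \<comment> \<open>The empty set is connected of length 0 and agrees almost everywhere with the
      single point \<open>{0..0}\<close>.\<close>
    have "AE x in lborel. x \<noteq> (0::real)" by (rule AE_lborel_singleton)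
    hence "AE x in lborel. x \<in> I \<longleftrightarrow> x \<in> {0..0 + r}"
      by eventually_elim (use True \<open>r = 0\<close> in auto)
    thus ?thesis using that meas by blast
  next
    case False
    then obtain c where c: "c \<in> I" by blast
    have len: "y - x \<le> r" if "x \<in> I" "y \<in> I" "x \<le> y" for x y
    proof -
      have "{x..y} \<subseteq> I" using I that by (metis connected_contains_Icc)
      hence "emeasure lborel {x..y} \<le> emeasure lborel I" using meas by (intro emeasure_mono) auto
      thus ?thesis using that r by simp
    qed
    have bnd: "c - r \<le> x \<and> x \<le> c + r" if "x \<in> I" for x
      using len[OF c that] len[OF that c] r by linarith
    have bb: "bdd_below I" "bdd_above I" using bnd by (auto simp: bdd_below_def bdd_above_def)
    define a b where "a = Inf I" and "b = Sup I"
    have sub: "I \<subseteq> {a..b}" unfolding a_def b_def using bb by (auto intro: cInf_lower cSup_upper)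
    have sup: "{a<..<b} \<subseteq> I"
    proof
      fix x assume "x \<in> {a<..<b}"
      then obtain y z where "y \<in> I" "y < x" "z \<in> I" "x < z"
        unfolding a_def b_def using False bb by (auto simp: cInf_less_iff less_cSup_iff)
      thus "x \<in> I" using connected_contains_Icc[OF I, of y z] by auto
    qed
    have ab: "a \<le> b" using sub c by auto
    have AE: "AE x in lborel. x \<in> I \<longleftrightarrow> x \<in> {a..b}"
      using AE_lborel_singleton[of a] AE_lborel_singleton[of b]
      by eventually_elim (use sub sup in force)
    hence "emeasure lborel I = emeasure lborel {a..b}"
      using meas by (intro emeasure_eq_AE) auto
    hence "b = a + r" using r ab by simp
    thus ?thesis using that AE meas by blast
  qed
qed

text \<open>The Fourier integral ignores null sets, and a translation changes the transform only by
  a phase.\<close>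

lemma T_set_connected:
  assumes "connected I" "0 \<le> r" "emeasure lborel I = ennreal r"
  shows "T_set s I = T s r"
proof -
  obtain a where a: "AE x in lborel. x \<in> I \<longleftrightarrow> x \<in> {a..a + r}" and [measurable]: "I \<in> sets borel"
    using connected_finite_measure_real assms by blast
  have "cmod (fourier (indicator I) \<xi>) = cmod (fourier (indicator {0..r}) \<xi>)" for \<xi>
  proof -
    have "fourier (indicator I) \<xi> = fourier (\<lambda>x. indicator {0..r} (x - a)) \<xi>"
      unfolding fourier_def
    proof (rule integral_cong_AE)
      show "AE x in lborel. indicator I x * exp (- \<i> * of_real x * of_real \<xi>)
          = indicator {0..r} (x - a) * exp (- \<i> * of_real x * of_real \<xi>)"
        using a by eventually_elim (auto simp: indicator_def)
    qed measurable
    thus ?thesis by (simp add: fourier_translate)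
  qed
  thus ?thesis by (simp add: T_def T_set_def)
qed

section \<open>Asymptotics\<close>

lemma continuous_red_symb:
  assumes "0 < s" "s < 1"
  shows "continuous_on A (red_symb s)"
proof -
  have "continuous_on A (\<lambda>\<xi>. hyp c (\<xi>\<^sup>2 / 4))" if "0 < c" for c
    by (rule continuous_on_compose2[OF continuous_hyp[OF that, of UNIV]]) (auto intro!: continuous_intros)
  moreover have "hyp s (\<xi>\<^sup>2 / 4) \<noteq> 0" for \<xi> using hyp_pos[of s "\<xi>\<^sup>2 / 4"] assms by simp
  ultimately show ?thesis unfolding red_symb_def[abs_def] using assms
    by (intro continuous_intros) auto
qed

lemma red_symb_pos:
  assumes "0 < s" "s < 1" shows "0 < red_symb s \<xi>"
  unfolding red_symb_def using assms
  by (intro mult_pos_pos divide_pos_pos hyp_pos Gamma_real_pos) auto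

text \<open>The factor \<open>4 powr (1 - s)\<close> compensates for the argument
  \<open>\<xi>\<^sup>2 / 4\<close> of \<open>bessel_ratio\<close>.\<close>

definition symb_const :: "real \<Rightarrow> real" where
  "symb_const s = 4 powr (1 - s) * Gamma (1 - s) / (2 * Gamma s)"

lemma symb_const_pos: "0 < s \<Longrightarrow> s < 1 \<Longrightarrow> 0 < symb_const s"
  unfolding symb_const_def by (intro mult_pos_pos divide_pos_pos Gamma_real_pos) auto

text \<open>Separates a bounded factor with a limit at infinity from a pure power. The decay bound
  and the scaling for small \<open>r\<close> both rest on this form.\<close>

lemma red_symb_conv_ratio:
  assumes "\<xi> \<noteq> 0"
  shows "red_symb s \<xi> = symb_const s * bessel_ratio s (\<xi>\<^sup>2 / 4) * \<bar>\<xi>\<bar> powr (2 * s - 2)"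
proof -
  have "4 powr (1 - s) * (\<xi>\<^sup>2 / 4) powr (1 - s) * \<bar>\<xi>\<bar> powr (2 * s - 2) = 1"
  proof -
    have "4 powr (1 - s) * (\<xi>\<^sup>2 / 4) powr (1 - s) = (\<bar>\<xi>\<bar> powr 2) powr (1 - s)"
      using assms by (simp flip: powr_mult)
    also have "\<dots> = \<bar>\<xi>\<bar> powr (2 * (1 - s))" by (rule powr_powr)
    finally show ?thesis using assms by (simp flip: powr_add)
  qed
  moreover have "symb_const s * bessel_ratio s (\<xi>\<^sup>2 / 4) * \<bar>\<xi>\<bar> powr (2 * s - 2)
    = (4 powr (1 - s) * (\<xi>\<^sup>2 / 4) powr (1 - s) * \<bar>\<xi>\<bar> powr (2 * s - 2)) * red_symb s \<xi>"
    unfolding red_symb_def bessel_ratio_def symb_const_def by (simp add: mult_ac)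
  ultimately show ?thesis by simp
qed

text \<open>On \<open>{-1..1}\<close> compactness gives a bound; outside, the bounded ratio leaves
  the power \<open>\<bar>\<xi>\<bar> powr (2 * s - 2)\<close>.\<close>

lemma red_symb_bound:
  assumes s: "0 < s" "s < 1"
  obtains C where "\<And>\<xi>. \<bar>red_symb s \<xi>\<bar> \<le> C * (1 + \<bar>\<xi>\<bar>) powr (2 * s - 2)"
proof -
  obtain P where P: "\<And>x. 0 < x \<Longrightarrow> bessel_ratio s x \<le> P"
    using bessel_ratio_bounded[OF s] by blast
  have "bounded (red_symb s ` {-1..1})"
    by (intro compact_imp_bounded compact_continuous_image continuous_red_symb s) auto
  then obtain M where M: "0 < M" "\<forall>y\<in>red_symb s ` {-1..1}. norm y \<le> M"
    unfolding bounded_pos by blast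
  define e where "e = 2 * s - 2"
  have e: "e \<le> 0" using s by (simp add: e_def)
  define B where "B = max M (symb_const s * P)"
  have B: "0 < B" using M by (simp add: B_def)
  have "red_symb s \<xi> \<le> B * (2 powr (- e) * (1 + \<bar>\<xi>\<bar>) powr e)" for \<xi>
  proof (cases "\<bar>\<xi>\<bar> \<le> 1")
    case True
    have "red_symb s \<xi> \<le> B * 1" using M(2) True by (force simp: B_def abs_le_iff)
    also have "\<dots> \<le> B * (2 powr (- e) * (1 + \<bar>\<xi>\<bar>) powr e)"
      using weight_bounds(1)[OF e True] B by (intro mult_left_mono) auto
    finally show ?thesis .
  next
    case False
    hence "\<xi> \<noteq> 0" by auto
    hence "red_symb s \<xi> = symb_const s * bessel_ratio s (\<xi>\<^sup>2 / 4) * \<bar>\<xi>\<bar> powr e"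
      by (simp add: red_symb_conv_ratio e_def)
    also have "\<dots> \<le> symb_const s * P * \<bar>\<xi>\<bar> powr e"
      using \<open>\<xi> \<noteq> 0\<close> symb_const_pos[OF s] by (intro mult_right_mono mult_left_mono P) auto
    also have "\<dots> \<le> B * \<bar>\<xi>\<bar> powr e" by (intro mult_right_mono) (auto simp: B_def)
    also have "\<dots> \<le> B * (2 powr (- e) * (1 + \<bar>\<xi>\<bar>) powr e)"
      using weight_bounds(2)[OF e, of \<xi>] False B by (intro mult_left_mono) auto
    finally show ?thesis .
  qed
  hence "\<bar>red_symb s \<xi>\<bar> \<le> (B * 2 powr (- e)) * (1 + \<bar>\<xi>\<bar>) powr (2 * s - 2)" for \<xi>
    using red_symb_pos[OF s, of \<xi>] by (simp add: e_def mult_ac)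
  thus ?thesis using that by blast
qed

text \<open>\<open>s < 1 / 2\<close> is what puts the decay exponent \<open>2 * s - 2\<close> below
  \<open>-1\<close>.\<close>

lemma integrable_red_symb:
  assumes s: "0 < s" "s < 1 / 2"
  shows "integrable lborel (red_symb s)"
proof -
  obtain C where C: "\<And>\<xi>. \<bar>red_symb s \<xi>\<bar> \<le> C * (1 + \<bar>\<xi>\<bar>) powr (2 * s - 2)"
    using red_symb_bound[of s] s by auto
  have [measurable]: "red_symb s \<in> borel_measurable borel"
    using s by (intro borel_measurable_continuous_onI continuous_red_symb) auto
  show ?thesis
  proof (rule Bochner_Integration.integrable_bound)
    show "integrable lborel (\<lambda>\<xi>. C * (1 + \<bar>\<xi>\<bar>) powr (2 * s - 2))"
      using integrable_weight[of "2 * s - 2"] s by simp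
    show "AE \<xi> in lborel. norm (red_symb s \<xi>) \<le> norm (C * (1 + \<bar>\<xi>\<bar>) powr (2 * s - 2))"
      by (intro AE_I2) (simp only: real_norm_def, rule order_trans[OF C abs_ge_self])
  qed measurable
qed

lemma integrable_red_symb_cos:
  assumes s: "0 < s" "s < 1 / 2"
  shows "integrable lborel (\<lambda>\<xi>. red_symb s \<xi> * cos (r * \<xi>))"
proof (rule Bochner_Integration.integrable_bound[OF integrable_red_symb[OF s]])
  have [measurable]: "red_symb s \<in> borel_measurable borel"
    using s by (intro borel_measurable_continuous_onI continuous_red_symb) auto
  show "(\<lambda>\<xi>. red_symb s \<xi> * cos (r * \<xi>)) \<in> borel_measurable lborel" by measurable
qed (auto simp: abs_mult mult_left_le)

section \<open>The integral \<open>T\<close>: real form, positivity and limits\<close>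

lemma integrable_T:
  assumes s: "0 < s" "s < 1 / 2"
  shows "integrable lborel (\<lambda>\<xi>. red_symb s \<xi> * (2 * (1 - cos (r * \<xi>))))"
proof -
  have "integrable lborel (\<lambda>\<xi>. 2 * red_symb s \<xi> - 2 * (red_symb s \<xi> * cos (r * \<xi>)))"
    using integrable_red_symb[OF s] integrable_red_symb_cos[OF s] by simp
  thus ?thesis by (simp add: algebra_simps)
qed

lemma T_eq:
  assumes s: "0 < s" "s < 1" and r: "0 \<le> r"
  shows "T s r = of_real (LINT \<xi>|lborel. red_symb s \<xi> * (2 * (1 - cos (r * \<xi>))))"
proof -
  have "symb s \<xi> * of_real ((cmod (fourier (indicator {0..r}) \<xi>))\<^sup>2)
      = of_real (red_symb s \<xi> * (2 * (1 - cos (r * \<xi>))))" for \<xi>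
  \<comment> \<open>At \<open>\<xi> = 0\<close> both sides are 0: on the left
    \<open>0 powr (2 * s) = 0\<close>, on the right \<open>1 - cos 0 = 0\<close>.\<close>
  proof (cases "\<xi> = 0")
    case False
    thus ?thesis
      unfolding cmod_fourier_indicator[OF r, symmetric] symb_eq[OF s False]
      by (simp add: mult_ac)
  qed (simp add: symb_def)
  thus ?thesis unfolding T_def T_set_def by (simp only: integral_complex_of_real)
qed

lemma T_pos:
  assumes s: "0 < s" "s < 1 / 2" and r: "0 < r"
  shows "0 < (LINT \<xi>|lborel. red_symb s \<xi> * (2 * (1 - cos (r * \<xi>))))"
\<comment> \<open>For \<open>\<xi>\<close> between 0 and \<open>pi / r\<close> the angle
  \<open>r * \<xi>\<close> stays inside \<open>(0, pi)\<close>, where the cosine is below 1.\<close>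
proof (rule lborel_integral_pos[OF integrable_T[OF s], of r 0 "pi / r"])
  fix \<xi> show "0 \<le> red_symb s \<xi> * (2 * (1 - cos (r * \<xi>)))"
    using red_symb_pos[of s \<xi>] s by simp
next
  fix \<xi> assume \<xi>: "0 < \<xi>" "\<xi> < pi / r"
  hence "cos (r * \<xi>) < cos 0" using r by (intro cos_monotone_0_pi) (auto simp: field_simps)
  thus "0 < red_symb s \<xi> * (2 * (1 - cos (r * \<xi>)))"
    using red_symb_pos[of s \<xi>] s by simp
qed (use r in simp)

lemma T_at_top:
  assumes s: "0 < s" "s < 1 / 2"
  shows "(T s \<longlongrightarrow> of_real (2 * (LINT \<xi>|lborel. red_symb s \<xi>))) at_top"
proof -
  have s1: "s < 1" using s by simp
  obtain C where C: "\<And>\<xi>. \<bar>red_symb s \<xi>\<bar> \<le> C * (1 + \<bar>\<xi>\<bar>) powr (2 * s - 2)"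
    using red_symb_bound[OF s(1) s1] by blast
  have "((\<lambda>r. LINT \<xi>|lborel. red_symb s \<xi> * cos (r * \<xi>)) \<longlongrightarrow> 0) at_top"
    using s C by (intro Riemann_Lebesgue_cos[where e="2 * s - 2"] continuous_red_symb) auto
  hence "((\<lambda>r. complex_of_real (2 * (LINT \<xi>|lborel. red_symb s \<xi>)
        - 2 * (LINT \<xi>|lborel. red_symb s \<xi> * cos (r * \<xi>))))
      \<longlongrightarrow> of_real (2 * (LINT \<xi>|lborel. red_symb s \<xi>) - 2 * 0)) at_top"
    by (intro tendsto_intros)
  moreover have "\<forall>\<^sub>F r in at_top. complex_of_real (2 * (LINT \<xi>|lborel. red_symb s \<xi>)
        - 2 * (LINT \<xi>|lborel. red_symb s \<xi> * cos (r * \<xi>))) = T s r"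
    using eventually_ge_at_top[of 0]
  proof eventually_elim
    case (elim r)
    have "(LINT \<xi>|lborel. red_symb s \<xi> * (2 * (1 - cos (r * \<xi>))))
      = (LINT \<xi>|lborel. 2 * red_symb s \<xi> - 2 * (red_symb s \<xi> * cos (r * \<xi>)))"
      by (simp add: algebra_simps)
    also have "\<dots> = 2 * (LINT \<xi>|lborel. red_symb s \<xi>) - 2 * (LINT \<xi>|lborel. red_symb s \<xi> * cos (r * \<xi>))"
      using integrable_red_symb[OF s] integrable_red_symb_cos[OF s]
      by (subst Bochner_Integration.integral_diff) auto
    finally show ?case by (simp only: T_eq[OF s(1) s1 elim])
  qed
  ultimately show ?thesis by (simp add: Lim_transform_eventually)
qed

text \<open>Provides the dominating function for small \<open>r\<close>. Near 0,
  \<open>2 * (1 - cos x) \<le> x\<^sup>2\<close> leaves the bounded power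
  \<open>\<bar>x\<bar> powr (2 * s)\<close>; away from 0 the cosine factor is at most 4.\<close>

lemma powr_one_minus_cos_le:
  fixes s x :: real
  assumes "0 < s" "s < 1"
  shows "\<bar>x\<bar> powr (2 * s - 2) * (2 * (1 - cos x)) \<le> 4 * 2 powr (2 - 2 * s) * (1 + \<bar>x\<bar>) powr (2 * s - 2)"
proof -
  define e where "e = 2 * s - 2"
  have e: "e \<le> 0" "- e = 2 - 2 * s" using assms by (auto simp: e_def)
  have "\<bar>x\<bar> powr e * (2 * (1 - cos x)) \<le> 4 * (2 powr (- e) * (1 + \<bar>x\<bar>) powr e)"
  proof (cases "\<bar>x\<bar> \<le> 1")
    case True
    have "2 * (1 - cos x) = 4 * (sin (x / 2))\<^sup>2"
      using cos_double_sin[of "x / 2"] by simp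
    also have "\<dots> \<le> 4 * (x / 2)\<^sup>2"
      using abs_sin_x_le_abs_x[of "x / 2"] by (simp only: abs_le_square_iff)
    finally have "\<bar>x\<bar> powr e * (2 * (1 - cos x)) \<le> \<bar>x\<bar> powr e * x\<^sup>2"
      by (intro mult_left_mono) (auto simp: power_divide)
    also have "\<bar>x\<bar> powr e * x\<^sup>2 \<le> 1"
    proof (cases "x = 0")
      case False
      hence "\<bar>x\<bar> powr e * x\<^sup>2 = \<bar>x\<bar> powr (2 * s)"
        by (simp add: e_def powr_diff)
      also have "\<dots> \<le> 1" using True assms by (intro powr_le1) auto
      finally show ?thesis .
    qed auto
    also have "1 \<le> 4 * (2 powr (- e) * (1 + \<bar>x\<bar>) powr e)"
      using weight_bounds(1)[OF e(1) True] by linarith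
    finally show ?thesis .
  next
    case False
    have "\<bar>x\<bar> powr e * (2 * (1 - cos x)) \<le> \<bar>x\<bar> powr e * 4"
      using cos_ge_minus_one[of x] by (intro mult_left_mono) (argo, simp)
    thus ?thesis using weight_bounds(2)[OF e(1), of x] False by linarith
  qed
  thus ?thesis by (simp add: e(2) e_def mult_ac)
qed

text \<open>Substitute \<open>\<xi> = R * x\<close> with \<open>R = 1 / r\<close>. The Jacobian
  \<open>R\<close> and the factor \<open>R powr (2 * s - 2)\<close> from
  \<open>red_symb_conv_ratio\<close> combine to \<open>r powr (1 - 2 * s)\<close>.\<close>

lemma T_scaling:
  assumes s: "0 < s" "s < 1" and R: "0 < R"
  shows "T s (inverse R) / of_real (inverse R powr (1 - 2 * s))
    = of_real (LINT x|lborel. symb_const s * bessel_ratio s ((R * x)\<^sup>2 / 4)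
        * (\<bar>x\<bar> powr (2 * s - 2) * (2 * (1 - cos x))))"
proof -
  let ?h = "\<lambda>x. symb_const s * bessel_ratio s ((R * x)\<^sup>2 / 4) * (\<bar>x\<bar> powr (2 * s - 2) * (2 * (1 - cos x)))"
  have "(LINT \<xi>|lborel. red_symb s \<xi> * (2 * (1 - cos (inverse R * \<xi>))))
      = R * (LINT x|lborel. red_symb s (R * x) * (2 * (1 - cos x)))"
  proof -
    have c: "inverse R * (R * x) = x" for x using R by (simp flip: mult.assoc)
    show ?thesis
      using R lborel_integral_real_affine[of R "\<lambda>\<xi>. red_symb s \<xi> * (2 * (1 - cos (inverse R * \<xi>)))" 0]
      by (simp add: c)
  qed
  also have "(\<lambda>x. red_symb s (R * x) * (2 * (1 - cos x))) = (\<lambda>x. R powr (2 * s - 2) * ?h x)"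
  proof
    fix x
    \<comment> \<open>\<open>red_symb_conv_ratio\<close> excludes \<open>x = 0\<close>, but there
      \<open>1 - cos x\<close> makes both sides 0.\<close>
    show "red_symb s (R * x) * (2 * (1 - cos x)) = R powr (2 * s - 2) * ?h x"
      using R by (cases "x = 0") (simp_all add: red_symb_conv_ratio abs_mult powr_mult mult_ac)
  qed
  also have "R * (LINT x|lborel. R powr (2 * s - 2) * ?h x) = R powr (2 * s - 1) * (LINT x|lborel. ?h x)"
  proof -
    have "R powr (2 * s - 1) = R powr (1 + (2 * s - 2))" by simp
    also have "\<dots> = R powr 1 * R powr (2 * s - 2)" by (rule powr_add)
    finally have "R powr (2 * s - 1) = R powr 1 * R powr (2 * s - 2)" .
    thus ?thesis using R by simp
  qed
  also have "R powr (2 * s - 1) = inverse R powr (1 - 2 * s)"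
    using R by (simp add: powr_minus[symmetric] inverse_powr)
  finally have "T s (inverse R) = of_real (inverse R powr (1 - 2 * s) * (LINT x|lborel. ?h x))"
    using T_eq[OF s, of "inverse R"] R by simp
  thus ?thesis using R by simp
qed

text \<open>In the scaled integral \<open>(R * x)\<^sup>2 / 4\<close> tends to infinity for each
  \<open>x \<noteq> 0\<close>, so the ratio tends to \<open>L\<close> while staying below
  \<open>P\<close>. Dominated convergence gives the limit \<open>symb_const s * L\<close> times the
  integral of \<open>?k\<close>.\<close>

lemma T_at_right_0:
  assumes s: "0 < s" "s < 1 / 2"
  obtains C where "0 < C" "((\<lambda>r. T s r / of_real (r powr (1 - 2 * s))) \<longlongrightarrow> of_real C) (at_right 0)"
proof -
  have s1: "s < 1" using s by simp
  obtain L where L: "0 < L" "(bessel_ratio s \<longlongrightarrow> L) at_top"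
    using bessel_ratio_limit[OF s(1) s1] by blast
  obtain P where P: "\<And>x. 0 < x \<Longrightarrow> bessel_ratio s x \<le> P"
    using bessel_ratio_bounded[OF s(1) s1] by blast
  let ?k = "\<lambda>x::real. \<bar>x\<bar> powr (2 * s - 2) * (2 * (1 - cos x))"
  let ?w = "\<lambda>x::real. 4 * 2 powr (2 - 2 * s) * (1 + \<bar>x\<bar>) powr (2 * s - 2)"
  let ?h = "\<lambda>R x. symb_const s * bessel_ratio s ((R * x)\<^sup>2 / 4) * ?k x"
  have K: "0 < symb_const s" by (rule symb_const_pos[OF s(1) s1])
  have P0: "0 < P" using P[of 1] bessel_ratio_pos[OF s(1) s1, of 1] by simp
  have k0: "0 \<le> ?k x" for x by simp
  have kw: "?k x \<le> ?w x" for x by (rule powr_one_minus_cos_le[OF s(1) s1])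
  have int_w: "integrable lborel ?w"
    using integrable_weight[of "2 * s - 2"] s by simp
  have [measurable]: "hyp s \<in> borel_measurable borel" "hyp (2 - s) \<in> borel_measurable borel"
    using s by (auto intro!: borel_measurable_continuous_onI continuous_hyp)
  have [measurable]: "bessel_ratio s \<in> borel_measurable borel"
    unfolding bessel_ratio_def[abs_def] by measurable
  have int_k: "integrable lborel ?k"
    by (rule Bochner_Integration.integrable_bound[OF int_w]) (use kw k0 in auto)
  define C where "C = (LINT x|lborel. symb_const s * L * ?k x)"
  have "0 < C" unfolding C_def
  proof (rule lborel_integral_pos[of _ 0 pi])
    show "integrable lborel (\<lambda>x. symb_const s * L * ?k x)" using int_k by simp
    show "0 \<le> symb_const s * L * ?k x" for x using K L by simp
    show "0 < symb_const s * L * ?k x" if "0 < x" "x < pi" for x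
      using that K L cos_monotone_0_pi[of 0 x] by simp
  qed simp
  moreover have lim: "((\<lambda>R. LINT x|lborel. ?h R x) \<longlongrightarrow> C) at_top"
    unfolding C_def
  proof (rule integral_dominated_convergence_at_top)
    show "integrable lborel (\<lambda>x. symb_const s * P * ?w x)" using int_w by simp
    show "AE x in lborel. ((\<lambda>R. ?h R x) \<longlongrightarrow> symb_const s * L * ?k x) at_top"
    proof (rule AE_I2)
      fix x :: real
      show "((\<lambda>R. ?h R x) \<longlongrightarrow> symb_const s * L * ?k x) at_top"
      proof (cases "x = 0")
        case False
        have "filterlim (\<lambda>R. x\<^sup>2 / 4 * R\<^sup>2) at_top at_top"
          using False
          by (intro filterlim_tendsto_pos_mult_at_top[OF tendsto_const] filterlim_pow_at_top filterlim_ident) auto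
        hence "filterlim (\<lambda>R. (R * x)\<^sup>2 / 4) at_top at_top"
          by (simp add: power_mult_distrib mult_ac)
        hence "((\<lambda>R. bessel_ratio s ((R * x)\<^sup>2 / 4)) \<longlongrightarrow> L) at_top"
          by (rule filterlim_compose[OF L(2)])
        thus ?thesis by (intro tendsto_intros)
      qed simp
    qed
    show "\<forall>\<^sub>F R in at_top. AE x in lborel. norm (?h R x) \<le> symb_const s * P * ?w x"
      using eventually_gt_at_top[of 0]
    proof eventually_elim
      case (elim R)
      show ?case
      proof (rule AE_I2)
        fix x :: real
        show "norm (?h R x) \<le> symb_const s * P * ?w x"
        proof (cases "x = 0")
          case False
          hence p: "0 < (R * x)\<^sup>2 / 4" using elim by simp
          have "norm (?h R x) = ?h R x"
            using K bessel_ratio_pos[OF s(1) s1 p] k0[of x] by simp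
          also have "\<dots> \<le> symb_const s * P * ?k x"
            using K P[OF p] k0[of x] by (intro mult_right_mono mult_left_mono) auto
          also have "\<dots> \<le> symb_const s * P * ?w x"
            using K P0 kw[of x] by (intro mult_left_mono) auto
          finally show ?thesis .
        qed (use K P0 in simp)
      qed
    qed
  qed measurable
  have "((\<lambda>r. T s r / of_real (r powr (1 - 2 * s))) \<longlongrightarrow> of_real C) (at_right 0)"
    \<comment> \<open>Replaces \<open>r\<close> tending to 0 from the right by
      \<open>inverse R\<close> with \<open>R\<close> tending to infinity, the variable of
      \<open>T_scaling\<close>.\<close>
    unfolding filterlim_at_right_to_top
  proof (rule Lim_transform_eventually)
    show "((\<lambda>R. complex_of_real (LINT x|lborel. ?h R x)) \<longlongrightarrow> of_real C) at_top"
      by (intro tendsto_of_real lim)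
    show "\<forall>\<^sub>F R in at_top. complex_of_real (LINT x|lborel. ?h R x)
        = T s (inverse R) / of_real (inverse R powr (1 - 2 * s))"
      using eventually_gt_at_top[of 0]
      by eventually_elim (rule T_scaling[OF s(1) s1, symmetric])
  qed
  ultimately show ?thesis using that by blast
qed

theorem proposition1p4:
  fixes s :: real
  assumes "0 < s" and "s < 1 / 2"
  shows "(\<forall>r\<ge>0. \<forall>I. connected I \<and> emeasure lborel I = ennreal r \<longrightarrow> T_set s I = T s r)
       \<and> (\<forall>r>0. T s r \<in> \<real> \<and> 0 < Re (T s r))
       \<and> (\<exists>C1 C2 :: real. 0 < C1 \<and> 0 < C2
            \<and> ((\<lambda>r. T s r / of_real (r powr (1 - 2 * s))) \<longlongrightarrow> of_real C1) (at_right 0)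
            \<and> ((\<lambda>r. T s r) \<longlongrightarrow> of_real C2) at_top)"
proof (intro conjI)
  show "\<forall>r\<ge>0. \<forall>I. connected I \<and> emeasure lborel I = ennreal r \<longrightarrow> T_set s I = T s r"
    using T_set_connected by blast
  show "\<forall>r>0. T s r \<in> \<real> \<and> 0 < Re (T s r)"
    using T_eq[of s] T_pos[OF assms] assms by simp
  obtain C1 where C1: "0 < C1"
    "((\<lambda>r. T s r / of_real (r powr (1 - 2 * s))) \<longlongrightarrow> of_real C1) (at_right 0)"
    using T_at_right_0[OF assms] by blast
  have "0 < (LINT \<xi>|lborel. red_symb s \<xi>)"
    using red_symb_pos[of s] assms
    by (intro lborel_integral_pos[OF integrable_red_symb[OF assms], of 0 1]) (auto intro: less_imp_le)
  hence "0 < 2 * (LINT \<xi>|lborel. red_symb s \<xi>)" by simp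
  with C1 T_at_top[OF assms]
  show "\<exists>C1 C2 :: real. 0 < C1 \<and> 0 < C2
      \<and> ((\<lambda>r. T s r / of_real (r powr (1 - 2 * s))) \<longlongrightarrow> of_real C1) (at_right 0)
      \<and> ((\<lambda>r. T s r) \<longlongrightarrow> of_real C2) at_top"
    by blast
qed

end
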